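(* Let $\mathcal A=(S,A)$ and $\mathcal A'=(S',A')$ be reaction systems. Then the transition graphs $G_{\mathcal A}$ and $G_{\mathcal A'}$ are isomorphic if and only if the $0$-context graphs $G^0_{\mathcal A}$ and $G^0_{\mathcal A'}$ are companions, i.e. if and only if the main skeletons $(\mathrm{Up}[R],R,\mathrm{res}_{\mathcal A})$ with $R=\mathrm{res}_{\mathcal A}(2^S)$ over $2^S$ and $(\mathrm{Up}[R'],R',\mathrm{res}_{\mathcal A'})$ with $R'=\mathrm{res}_{\mathcal A'}(2^{S'})$ over $2^{S'}$ are companion skeletons.
   Context: A reaction system is a pair $\mathcal A=(S,A)$ with $S$ a finite set and $A\subseteq(2^S\setminus\{\varnothing\})\times(2^S\setminus\{\varnothing\})\times 2^S$ a set of reactions $(R,I,P)$; $a=(R,I,P)$ is enabled in $X\subseteq S$ iff $R\subseteq X$ and $I\cap X=\varnothing$; $\mathrm{res}_a(X)=P$ if enabled and $\varnothing$ otherwise; $\mathrm{res}_{\mathcal A}(X)=\bigcup_{a\in A}\mathrm{res}_a(X)$. The $0$-context graph $G^0_{\mathcal A}$ has vertex set $2^S$ and edges $(v,\mathrm{res}_{\mathcal A}(v))$; the transition graph $G_{\mathcal A}$ has vertex set $2^S$ and edges $(v,w)$ with $\mathrm{res}_{\mathcal A}(v)\subseteq w$. In $(2^S,\subseteq)$, $\mathrm{Up}(X)=\{Y\subseteq S\mid X\subseteq Y\}$ and $\mathrm{Up}[R]=\{\mathrm{Up}(X)\mid X\in R\}$, where the cone $\mathrm{Up}(X)$ is indexed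 by $X$. A skeleton over a finite set $V$ is a triple $(\mathcal O,R,f)$ where $R\subseteq V$, $\mathcal O=\{O_z\mid z\in R\}$ is a family of subsets of $V$ indexed injectively by $R$ with $|\mathcal O|\le |V|$, and $f:V\to R$ is a surjection. For a family $\mathcal O$, $\mathcal O^\cap$ is the smallest family containing $\mathcal O$ closed under intersection of two sets; a faithful correspondence is a bijection $\eta:\mathcal O^\cap\to\mathcal P^\cap$ with $|X|=|\eta(X)|$ and $\eta(X\cap Y)=\eta(X)\cap\eta(Y)$. Skeletons $(\mathcal O,R,f)$ over $V$ and $(\mathcal P,Q,g)$ over $W$ are companions if there is a bijection $\eta:V\to W$ whose elementwise extension to subsets restricts to a faithful correspondence $\mathcal O^\cap\to\mathcal P^\cap$ and satisfies $\eta(O_{f(x)})=P_{g(\eta(x))}$ for all $x\in V$. *)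

theory Defs
  imports "Graph_Theory.Graph_Theory"
begin

section \<open>Reaction systems\<close>

text \<open>A reaction is a triple of reactants, inhibitors and products.\<close>

type_synonym 'a reaction = "'a set \<times> 'a set \<times> 'a set"

definition reaction_system :: "'a set \<Rightarrow> 'a reaction set \<Rightarrow> bool" where
  "reaction_system S A \<longleftrightarrow>
     finite S \<and> A \<subseteq> (Pow S - {{}}) \<times> (Pow S - {{}}) \<times> Pow S"

fun enabled :: "'a reaction \<Rightarrow> 'a set \<Rightarrow> bool" where
  "enabled (R, I, P) X \<longleftrightarrow> R \<subseteq> X \<and> I \<inter> X = {}"

fun res_reaction :: "'a reaction \<Rightarrow> 'a set \<Rightarrow> 'a set" where
  "res_reaction (R, I, P) X = (if enabled (R, I, P) X then P else {})"

definition res :: "'a reaction set \<Rightarrow> 'a set \<Rightarrow> 'a set" where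
  "res A X = (\<Union>a\<in>A. res_reaction a X)"

definition zero_context_graph :: "'a set \<Rightarrow> 'a reaction set \<Rightarrow> 'a set pair_pre_digraph" where
  "zero_context_graph S A =
     \<lparr>pverts = Pow S, parcs = {(v, w). v \<in> Pow S \<and> w = res A v}\<rparr>"

definition transition_graph :: "'a set \<Rightarrow> 'a reaction set \<Rightarrow> 'a set pair_pre_digraph" where
  "transition_graph S A =
     \<lparr>pverts = Pow S, parcs = {(v, w). v \<in> Pow S \<and> w \<in> Pow S \<and> res A v \<subseteq> w}\<rparr>"


section \<open>Skeletons and companions\<close>

text \<open>A triple \<open>(C, R, f)\<close>: the indexed family is \<open>C z\<close> for \<open>z \<in> R\<close>, so the family
  as a set of sets is \<open>C ` R\<close>. The values of \<open>C\<close> off \<open>R\<close>, and of \<open>f\<close> off the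
  underlying set \<open>V\<close>, are irrelevant.\<close>

type_synonym 'v skeleton = "('v \<Rightarrow> 'v set) \<times> 'v set \<times> ('v \<Rightarrow> 'v)"

fun is_skeleton :: "'v set \<Rightarrow> 'v skeleton \<Rightarrow> bool" where
  "is_skeleton V (C, R, f) \<longleftrightarrow>
     finite V \<and> R \<subseteq> V \<and> C ` R \<subseteq> Pow V \<and> inj_on C R \<and> card (C ` R) \<le> card V \<and> f ` V = R"

text \<open>Only intersections of two members are taken: the empty intersection is not added.\<close>

inductive_set inter_closure :: "'v set set \<Rightarrow> 'v set set" for F :: "'v set set" where
  base: "X \<in> F \<Longrightarrow> X \<in> inter_closure F"
| inter: "X \<in> inter_closure F \<Longrightarrow> Y \<in> inter_closure F \<Longrightarrow> X \<inter> Y \<in> inter_closure F"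

definition faithful_correspondence ::
    "'v set set \<Rightarrow> 'w set set \<Rightarrow> ('v set \<Rightarrow> 'w set) \<Rightarrow> bool" where
  "faithful_correspondence F G h \<longleftrightarrow>
     bij_betw h (inter_closure F) (inter_closure G) \<and>
     (\<forall>X \<in> inter_closure F. card X = card (h X)) \<and>
     (\<forall>X \<in> inter_closure F. \<forall>Y \<in> inter_closure F. h (X \<inter> Y) = h X \<inter> h Y)"

fun companion_skeletons :: "'v set \<Rightarrow> 'v skeleton \<Rightarrow> 'w set \<Rightarrow> 'w skeleton \<Rightarrow> bool" where
  "companion_skeletons V (C, R, f) W (D, Q, g) \<longleftrightarrow>
     is_skeleton V (C, R, f) \<and> is_skeleton W (D, Q, g) \<and>
     (\<exists>\<eta>. bij_betw \<eta> V W \<and>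
          faithful_correspondence (C ` R) (D ` Q) (image \<eta>) \<and>
          (\<forall>x \<in> V. \<eta> ` C (f x) = D (g (\<eta> x))))"

text \<open>\<open>V\<close> is the ground set of the poset, ordered by inclusion; for \<open>V = Pow S\<close> this is
  the cone of \<open>X\<close> in the subsets of \<open>S\<close>.\<close>

definition up :: "'a set set \<Rightarrow> 'a set \<Rightarrow> 'a set set" where
  "up V X = {Y \<in> V. X \<subseteq> Y}"

text \<open>The main skeleton of a graph on sets in which every vertex has exactly one outgoing
  arc: the successor function, its range, and the cones of the members of that range.\<close>

definition main_skeleton :: "'a set pair_pre_digraph \<Rightarrow> 'a set skeleton" where
  "main_skeleton G = (up (pverts G), snd ` parcs G, \<lambda>v. THE w. (v, w) \<in> parcs G)"

definition companion_graphs :: "'a set pair_pre_digraph \<Rightarrow> 'b set pair_pre_digraph \<Rightarrow> bool" where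
  "companion_graphs G H \<longleftrightarrow>
     companion_skeletons (pverts G) (main_skeleton G) (pverts H) (main_skeleton H)"

end

theory Submission
  imports Defs
begin

text \<open>The out-neighbourhood of a vertex \<open>v\<close> of the transition graph is the cone of \<open>res A v\<close>.
  Hence a bijection \<open>\<eta>\<close> of the vertices is a graph isomorphism iff it maps each cone
  \<open>up (Pow S) (res A v)\<close> onto \<open>up (Pow S') (res A' (\<eta> v))\<close>, which is the last clause
  in the definition of companion skeletons. The faithful correspondence is then automatic, because
  an injective map commutes with intersections and preserves cardinalities.\<close>

lemma res_mem_Pow:
  assumes "reaction_system S A"
  shows "res A X \<in> Pow S"
proof -
  have "res_reaction a X \<subseteq> S" if "a \<in> A" for a
    using that assms by (cases a) (auto simp: reaction_system_def)
  then show ?thesis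
    by (auto simp: res_def)
qed

text \<open>An arc of \<open>with_proj G\<close> is the pair of its ends, so the vertex map of an
  isomorphism determines its arc map. This reduces the library notion to one vertex bijection; the
  conjunct \<open>wf_digraph\<close> stays because \<open>digraph_isomorphism\<close> contains
  it.\<close>

lemma digraph_iso_with_proj_iff:
  "digraph_iso (with_proj G) (with_proj H) \<longleftrightarrow>
     wf_digraph (with_proj G) \<and>
     (\<exists>h. bij_betw h (pverts G) (pverts H) \<and> parcs H = map_prod h h ` parcs G)"
proof (intro iffI conjI)
  assume "digraph_iso (with_proj G) (with_proj H)"
  then obtain f where iso: "pre_digraph.digraph_isomorphism (with_proj G) f"
    and H: "with_proj H = app_iso f (with_proj G)"
    by (auto simp: digraph_iso_def)
  from iso show wf: "wf_digraph (with_proj G)"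
    by (simp add: pre_digraph.digraph_isomorphism_def)
  have "pverts H = iso_verts f ` pverts G"
    using arg_cong[OF H, of verts] by simp
  then have "bij_betw (iso_verts f) (pverts G) (pverts H)"
    using iso by (simp add: pre_digraph.digraph_isomorphism_def bij_betw_def)
  \<comment> \<open>For a graph of the form \<open>with_proj\<close>, \<open>arcs_ends\<close> is
    \<open>parcs\<close>, so \<open>iso_arcs f\<close> drops out.\<close>
  moreover have "parcs H = map_prod (iso_verts f) (iso_verts f) ` parcs G"
    using wf_digraph.arcs_ends_app_iso_eq[OF wf iso] by (simp flip: H add: map_prod_def)
  ultimately show "\<exists>h. bij_betw h (pverts G) (pverts H) \<and> parcs H = map_prod h h ` parcs G"
    by blast
next
  assume "wf_digraph (with_proj G) \<and>
    (\<exists>h. bij_betw h (pverts G) (pverts H) \<and> parcs H = map_prod h h ` parcs G)"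
  then obtain h where wf: "wf_digraph (with_proj G)"
    and h: "bij_betw h (pverts G) (pverts H)" and arcs: "parcs H = map_prod h h ` parcs G"
    by blast
  \<comment> \<open>\<open>app_iso\<close> takes its new head and tail functions from the
    isomorphism; those of \<open>with_proj H\<close> are \<open>snd\<close> and
    \<open>fst\<close>.\<close>
  let ?f = "\<lparr>iso_verts = h, iso_arcs = map_prod h h, iso_head = snd, iso_tail = fst\<rparr>"
  have "parcs G \<subseteq> pverts G \<times> pverts G"
    using wf_digraph.tail_in_verts[OF wf] wf_digraph.head_in_verts[OF wf] by fastforce
  then have "inj_on (map_prod h h) (parcs G)"
    using h by (auto simp: bij_betw_def intro: inj_on_subset map_prod_inj_on)
  then have "pre_digraph.digraph_isomorphism (with_proj G) ?f"
    using wf h by (simp add: pre_digraph.digraph_isomorphism_def bij_betw_def)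
  moreover have "with_proj H = app_iso ?f (with_proj G)"
    using h arcs by (simp add: with_proj_def app_iso_def bij_betw_def)
  ultimately show "digraph_iso (with_proj G) (with_proj H)"
    unfolding digraph_iso_def by blast
qed

lemma inter_closure_subset_Pow:
  assumes "F \<subseteq> Pow V"
  shows "inter_closure F \<subseteq> Pow V"
proof
  fix X assume "X \<in> inter_closure F"
  then show "X \<in> Pow V"
    by induction (use assms in auto)
qed

text \<open>On subsets of \<open>V\<close> the image under \<open>h\<close> commutes with binary
  intersections, so each inclusion follows by induction on the closure.\<close>

lemma inter_closure_image:
  assumes "inj_on h V" and "F \<subseteq> Pow V"
  shows "inter_closure (image h ` F) = image h ` inter_closure F"
proof (intro equalityI subsetI)
  have image_Int: "h ` (X \<inter> Y) = h ` X \<inter> h ` Y"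
    if "X \<in> inter_closure F" "Y \<in> inter_closure F" for X Y
    using that inter_closure_subset_Pow[OF assms(2)]
    by (intro inj_on_image_Int[OF assms(1)]) auto
  show "Z \<in> image h ` inter_closure F" if "Z \<in> inter_closure (image h ` F)" for Z
    using that
  proof induction
    case (base Z)
    then show ?case by (auto intro: inter_closure.base)
  next
    case (inter Z Z')
    then obtain X Y where "X \<in> inter_closure F" "Y \<in> inter_closure F" "Z = h ` X" "Z' = h ` Y"
      by blast
    then show ?case
      by (metis inter_closure.inter image_Int imageI)
  qed
  have "h ` X \<in> inter_closure (image h ` F)" if "X \<in> inter_closure F" for X
    using that
  proof induction
    case (base X)
    then show ?case by (auto intro: inter_closure.base)
  next
    case (inter X Y)
    then show ?case
      by (simp add: image_Int inter_closure.inter)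
  qed
  then show "Z \<in> inter_closure (image h ` F)" if "Z \<in> image h ` inter_closure F" for Z
    using that by blast
qed

lemma faithful_correspondence_image:
  assumes "inj_on h V" and "F \<subseteq> Pow V"
  shows "faithful_correspondence F (image h ` F) (image h)"
proof -
  note sub = inter_closure_subset_Pow[OF assms(2)]
  have "inj_on (image h) (inter_closure F)"
    using inj_on_image_Pow[OF assms(1)] sub by (rule inj_on_subset)
  moreover have "card X = card (h ` X)" if "X \<in> inter_closure F" for X
    using that sub by (metis PowD assms(1) card_image inj_on_subset subsetD)
  moreover have "h ` (X \<inter> Y) = h ` X \<inter> h ` Y"
    if "X \<in> inter_closure F" "Y \<in> inter_closure F" for X Y
    using that sub by (intro inj_on_image_Int[OF assms(1)]) auto
  ultimately show ?thesis
    by (simp add: faithful_correspondence_def inter_closure_image[OF assms] bij_betw_def)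
qed

text \<open>Each member of \<open>V\<close> is the least element of its own cone, so equal cones
  have equal indices.\<close>

lemma is_skeleton_up:
  assumes "finite V" and "f ` V \<subseteq> V"
  shows "is_skeleton V (up V, f ` V, f)"
proof -
  have "inj_on (up V) (f ` V)"
    using assms(2) by (auto simp: inj_on_def up_def)
  moreover have "card (up V ` f ` V) \<le> card V"
    unfolding image_image using assms(1) by (rule card_image_le)
  ultimately show ?thesis
    using assms by (auto simp: up_def)
qed

lemma companion_skeletons_up_iff:
  assumes "finite V" "f ` V \<subseteq> V" "finite W" "g ` W \<subseteq> W"
  shows "companion_skeletons V (up V, f ` V, f) W (up W, g ` W, g) \<longleftrightarrow>
    (\<exists>\<eta>. bij_betw \<eta> V W \<and> (\<forall>x\<in>V. \<eta> ` up V (f x) = up W (g (\<eta> x))))"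
proof -
  have "faithful_correspondence (up V ` f ` V) (up W ` g ` W) (image \<eta>)"
    if \<eta>: "bij_betw \<eta> V W" and cones: "\<forall>x\<in>V. \<eta> ` up V (f x) = up W (g (\<eta> x))" for \<eta>
  proof -
    \<comment> \<open>Surjectivity of \<open>\<eta>\<close> reindexes the cones in \<open>W\<close>
      by \<open>V\<close>, where the hypothesis \<open>cones\<close> applies.\<close>
    have "up W ` g ` W = (\<lambda>x. up W (g (\<eta> x))) ` V"
      using \<eta> by (auto simp: bij_betw_def)
    also have "\<dots> = image \<eta> ` up V ` f ` V"
      using cones by (auto simp: image_image intro!: image_cong)
    finally have "up W ` g ` W = image \<eta> ` up V ` f ` V" .
    then show ?thesis
      using \<eta> by (auto simp: bij_betw_def up_def intro!: faithful_correspondence_image)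
  qed
  then show ?thesis
    using is_skeleton_up[of V f] is_skeleton_up[of W g] assms
    by (auto simp del: is_skeleton.simps)
qed

text \<open>Needed because the \<open>THE\<close> term in \<open>main_skeleton\<close> is known to
  agree with \<open>res A\<close> only on the vertices.\<close>

lemma companion_skeletons_cong:
  assumes "\<And>x. x \<in> V \<Longrightarrow> f x = f' x" and "\<And>x. x \<in> W \<Longrightarrow> g x = g' x"
  shows "companion_skeletons V (C, R, f) W (D, Q, g) \<longleftrightarrow>
    companion_skeletons V (C, R, f') W (D, Q, g')"
proof -
  have "f ` V = f' ` V" "g ` W = g' ` W"
    using assms by (auto intro!: image_cong)
  moreover have "(\<forall>x\<in>V. \<eta> ` C (f x) = D (g (\<eta> x))) \<longleftrightarrow> (\<forall>x\<in>V. \<eta> ` C (f' x) = D (g' (\<eta> x)))"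
    if "bij_betw \<eta> V W" for \<eta>
    using that assms by (simp add: bij_betwE cong: ball_cong)
  ultimately show ?thesis
    by (simp cong: conj_cong)
qed

lemma main_skeleton_zero_context_graph:
  "main_skeleton (zero_context_graph S A) =
     (up (Pow S), res A ` Pow S, \<lambda>v. THE w. v \<in> Pow S \<and> w = res A v)"
proof -
  have "{(v, w). v \<in> Pow S \<and> w = res A v} = (\<lambda>v. (v, res A v)) ` Pow S"
    by blast
  then have "snd ` {(v, w). v \<in> Pow S \<and> w = res A v} = res A ` Pow S"
    by (simp only: image_image snd_conv)
  then show ?thesis
    unfolding main_skeleton_def zero_context_graph_def pair_pre_digraph.simps
    by (simp only: mem_Collect_eq prod.case)
qed

lemma companion_graphs_zero_context_graph_iff:
  "companion_graphs (zero_context_graph S A) (zero_context_graph S' A') \<longleftrightarrow>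
     companion_skeletons (Pow S) (up (Pow S), res A ` Pow S, res A)
       (Pow S') (up (Pow S'), res A' ` Pow S', res A')"
proof -
  have "pverts (zero_context_graph S A) = Pow S" "pverts (zero_context_graph S' A') = Pow S'"
    by (simp_all add: zero_context_graph_def)
  then show ?thesis
    unfolding companion_graphs_def main_skeleton_zero_context_graph
    by (simp only:) (rule companion_skeletons_cong; simp)
qed

lemma Sigma_eq_map_prod_image_iff:
  assumes "bij_betw h V W"
  shows "Sigma W D = map_prod h h ` Sigma V C \<longleftrightarrow> (\<forall>x\<in>V. h ` C x = D (h x))"
proof -
  have "map_prod h h ` Sigma V C = (SIGMA v:W. h ` C (the_inv_into V h v))"
    using assms by (force simp: bij_betw_def the_inv_into_f_f)
  moreover have "\<dots> = Sigma W D \<longleftrightarrow> (\<forall>v\<in>W. h ` C (the_inv_into V h v) = D v)"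
    by (auto simp: set_eq_iff)
  moreover have "\<dots> \<longleftrightarrow> (\<forall>x\<in>V. h ` C x = D (h x))"
    using bij_betw_imp_surj_on[OF assms, symmetric] bij_betw_imp_inj_on[OF assms]
    by (simp add: the_inv_into_f_f)
  ultimately show ?thesis
    by metis
qed

lemma pverts_transition_graph: "pverts (transition_graph S A) = Pow S"
  by (simp add: transition_graph_def)

text \<open>The \<open>Sigma\<close> form exhibits the cones as out-neighbourhoods, ready for the
  fibrewise comparison.\<close>

lemma parcs_transition_graph:
  "parcs (transition_graph S A) = (SIGMA v:Pow S. up (Pow S) (res A v))"
  by (auto simp: transition_graph_def up_def)

lemma digraph_iso_transition_graph_iff:
  "digraph_iso (with_proj (transition_graph S A)) (with_proj (transition_graph S' A'))
    \<longleftrightarrow> (\<exists>\<eta>. bij_betw \<eta> (Pow S) (Pow S') \<and>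
          (\<forall>x\<in>Pow S. \<eta> ` up (Pow S) (res A x) = up (Pow S') (res A' (\<eta> x))))"
proof -
  have "wf_digraph (with_proj (transition_graph S A))"
    by standard (auto simp: transition_graph_def)
  then show ?thesis
    by (simp add: digraph_iso_with_proj_iff pverts_transition_graph parcs_transition_graph
        Sigma_eq_map_prod_image_iff cong: conj_cong)
qed

theorem theorem5p7:
  fixes S :: "'a set" and A :: "'a reaction set"
    and S' :: "'b set" and A' :: "'b reaction set"
  assumes "reaction_system S A" and "reaction_system S' A'"
  shows "(digraph_iso (with_proj (transition_graph S A)) (with_proj (transition_graph S' A'))
            \<longleftrightarrow> companion_graphs (zero_context_graph S A) (zero_context_graph S' A')) \<and>
         (digraph_iso (with_proj (transition_graph S A)) (with_proj (transition_graph S' A'))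
            \<longleftrightarrow> companion_skeletons
                  (Pow S) (up (Pow S), res A ` Pow S, res A)
                  (Pow S') (up (Pow S'), res A' ` Pow S', res A'))"
proof -
  have fin: "finite (Pow S)" "finite (Pow S')"
    using assms by (auto simp: reaction_system_def)
  have sub: "res A ` Pow S \<subseteq> Pow S" "res A' ` Pow S' \<subseteq> Pow S'"
    using res_mem_Pow[OF assms(1)] res_mem_Pow[OF assms(2)] by blast+
  show ?thesis
    \<comment> \<open>All three statements rewrite to the same existential over
      \<open>\<eta>\<close>.\<close>
    by (simp only: companion_graphs_zero_context_graph_iff digraph_iso_transition_graph_iff
        companion_skeletons_up_iff[OF fin(1) sub(1) fin(2) sub(2)])
qed

end
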